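(* Let $(q_n)_{n\geq 1}$ be the sequence of modeled primes given by Model 1, i.e. $q_1=2$ and, for $n\geq 2$, $$q_n = 1+2\sum_{k=1}^{n-1}\left\lceil \frac{d(k)}{2}\right\rceil .$$ Then $q_n \sim n\log n$ as $n\to\infty$, i.e. $\lim_{n\to\infty} \dfrac{q_n}{n\log n}=1$.
   Context: Here $d(k)$ is the divisor function, the number of positive divisors of the positive integer $k$; $\lceil x\rceil$ is the ceiling function; and $\log$ is the natural logarithm. "Model 1" is the name of the displayed sequence $(q_n)$, whose terms are intended as a model of the sequence of prime numbers; the statement concerns only this explicitly defined sequence. *)

theory Defs
  imports Complex_Main "HOL-Library.Landau_Symbols"
begin

definition divisor_count :: "nat \<Rightarrow> nat" where
  "divisor_count k = card {d. d dvd k}"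

text \<open>The sequence is indexed from 1; the value at index 0 is irrelevant.\<close>

definition model_prime :: "nat \<Rightarrow> int" where
  "model_prime n =
     (if n = 1 then 2 else 1 + 2 * (\<Sum>k = 1..n - 1. \<lceil>real (divisor_count k) / 2\<rceil>))"

end

theory Submission
  imports Defs "HOL-Analysis.Harmonic_Numbers" "HOL-Real_Asymp.Real_Asymp"
begin

text \<open>
  Write \<open>D(m)\<close> for the sum of the number of divisors \<open>d(k)\<close> over \<open>1 \<le> k \<le> m\<close>. Since
  \<open>x \<le> 2 * \<lceil>x / 2\<rceil> \<le> x + 1\<close> for an integer \<open>x\<close>, for \<open>n \<ge> 2\<close> the \<open>n\<close>-th modeled prime differs
  from \<open>D(n - 1)\<close> by at most \<open>n\<close>. Counting pairs \<open>(j, k)\<close> with \<open>j\<close> dividing \<open>k\<close> in the other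
  order shows that \<open>D(m)\<close> is the sum of \<open>\<lfloor>m / j\<rfloor>\<close> over \<open>1 \<le> j \<le> m\<close> (\<open>sum_divisor_count\<close>), which
  is within \<open>m\<close> of \<open>m\<close> times the harmonic number \<open>H\<^sub>m\<close>. As \<open>ln (m + 1) \<le> H\<^sub>m \<le> ln m + 1\<close> for
  \<open>m \<ge> 1\<close>, the modeled prime is squeezed between two explicit functions (\<open>model_prime_bounds\<close>)
  that are both asymptotic to \<open>n * ln n\<close>; no finer divisor-sum asymptotics are needed.
\<close>

lemma card_multiples_atMost:
  fixes m j :: nat
  assumes "j \<ge> 1"
  shows "card {k \<in> {1..m}. j dvd k} = m div j"
proof -
  have "{k \<in> {1..m}. j dvd k} = (\<lambda>i. j * i) ` {1..m div j}"
  proof (intro equalityI subsetI)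
    fix k assume "k \<in> {k \<in> {1..m}. j dvd k}"
    then obtain i where "k = j * i" "1 \<le> j * i" "j * i \<le> m" by auto
    moreover from this have "i \<ge> 1" by (cases i) auto
    moreover have "i \<le> m div j"
      using assms \<open>j * i \<le> m\<close> by (simp add: less_eq_div_iff_mult_less_eq mult.commute)
    ultimately show "k \<in> (\<lambda>i. j * i) ` {1..m div j}" by auto
  next
    fix k assume "k \<in> (\<lambda>i. j * i) ` {1..m div j}"
    then show "k \<in> {k \<in> {1..m}. j dvd k}"
      using assms by (auto simp: less_eq_div_iff_mult_less_eq mult.commute)
  qed
  moreover have "inj_on (\<lambda>i. j * i) {1..m div j}"
    using assms by (auto simp: inj_on_def)
  ultimately show ?thesis by (simp add: card_image)
qed

lemma sum_divisor_count: "(\<Sum>k = 1..m. divisor_count k) = (\<Sum>j = 1..m. m div j)"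
proof -
  have "divisor_count k = (\<Sum>j = 1..m. if j dvd k then 1 else 0)" if "k \<in> {1..m}" for k
  proof -
    have "{d. d dvd k} = {d \<in> {1..m}. d dvd k}"
      using that by (auto dest: dvd_imp_le intro: Suc_leI dvd_pos_nat)
    then have "divisor_count k = card {d \<in> {1..m}. d dvd k}"
      by (simp add: divisor_count_def)
    then show ?thesis by (simp flip: sum.inter_filter)
  qed
  then have "(\<Sum>k = 1..m. divisor_count k)
      = (\<Sum>k = 1..m. \<Sum>j = 1..m. if j dvd k then 1 else 0)"
    by (rule sum.cong[OF refl])
  also have "\<dots> = (\<Sum>j = 1..m. \<Sum>k = 1..m. if j dvd k then 1 else 0)"
    by (rule sum.swap)
  also have "\<dots> = (\<Sum>j = 1..m. m div j)"
  proof (rule sum.cong[OF refl])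
    fix j assume "j \<in> {1..m}"
    then have "card {k \<in> {1..m}. j dvd k} = m div j"
      by (intro card_multiples_atMost) simp
    then show "(\<Sum>k = 1..m. if j dvd k then 1 else 0) = m div j"
      by (simp flip: sum.inter_filter)
  qed
  finally show ?thesis .
qed

lemma sum_divisor_count_bounds:
  fixes m :: nat
  defines "D \<equiv> real (\<Sum>k = 1..m. divisor_count k)"
  shows "real m * harm m - real m \<le> D" and "D \<le> real m * harm m"
proof -
  have D: "D = (\<Sum>j = 1..m. real (m div j))"
    unfolding D_def sum_divisor_count by (rule of_nat_sum)
  have H: "real m * harm m = (\<Sum>j = 1..m. real m / real j)"
    by (simp add: harm_def sum_distrib_left divide_inverse)
  have "real m / real j - 1 \<le> real (m div j)" for j
    using floor_divide_of_nat_eq[of m j, where ?'a = real] by linarith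
  then have "(\<Sum>j = 1..m. real m / real j - 1) \<le> D"
    unfolding D by (intro sum_mono)
  then show "real m * harm m - real m \<le> D"
    by (simp add: H sum_subtractf)
  show "D \<le> real m * harm m"
    unfolding D H by (intro sum_mono of_nat_div_le_of_nat)
qed

lemma model_prime_bounds:
  assumes "n \<ge> 2"
  shows "1 + (real n - 1) * (ln (real n) - 1) \<le> real_of_int (model_prime n)"
    and "real_of_int (model_prime n) \<le> 1 + (real n - 1) * (ln (real n) + 2)"
proof -
  define m where "m = n - 1"
  have m: "m \<ge> 1" "n = Suc m" "real n = real m + 1"
    using assms by (auto simp: m_def)
  define D where "D = real (\<Sum>k = 1..m. divisor_count k)"
  have q: "real_of_int (model_prime n)
      = 1 + (\<Sum>k = 1..m. 2 * real_of_int \<lceil>real (divisor_count k) / 2\<rceil>)"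
    using assms by (simp add: model_prime_def m_def sum_distrib_left)
  have "D \<le> (\<Sum>k = 1..m. 2 * real_of_int \<lceil>real (divisor_count k) / 2\<rceil>)"
    unfolding D_def of_nat_sum by (intro sum_mono) linarith
  then have lo: "1 + D \<le> real_of_int (model_prime n)"
    using q by simp
  \<comment> \<open>Strictness matters: \<open>2 * \<lceil>x / 2\<rceil> < x + 2\<close> sharpens to \<open>\<le> x + 1\<close> because both sides are integers.\<close>
  have ceil: "2 * real_of_int \<lceil>real x / 2\<rceil> \<le> real x + 1" for x :: nat
  proof -
    have "2 * \<lceil>real x / 2\<rceil> < int x + 2" by linarith
    then show ?thesis by linarith
  qed
  have "(\<Sum>k = 1..m. 2 * real_of_int \<lceil>real (divisor_count k) / 2\<rceil>)
      \<le> (\<Sum>k = 1..m. real (divisor_count k) + 1)"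
    by (intro sum_mono ceil)
  then have hi: "real_of_int (model_prime n) \<le> 1 + D + real m"
    by (simp add: q D_def sum.distrib)
  have "ln (real n) \<le> harm m"
    using ln_le_harm[of m] m by (simp add: add.commute)
  then have "real m * ln (real n) - real m \<le> D"
    using sum_divisor_count_bounds(1)[of m] mult_left_mono[of "ln (real n)" "harm m" "real m"]
    unfolding D_def by linarith
  then show "1 + (real n - 1) * (ln (real n) - 1) \<le> real_of_int (model_prime n)"
    using lo m(3) by (simp add: algebra_simps)
  have "harm m \<le> ln (real n) + (1 :: real)"
  proof -
    have "harm m - ln (real m) \<le> (1 :: real)"
      using euler_mascheroni_sequence_decreasing[of 1 m] m by (simp add: harm_def)
    moreover have "ln (real m) \<le> ln (real n)"
      using m by (intro ln_mono) auto
    ultimately show ?thesis by linarith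
  qed
  then have "D \<le> real m * (ln (real n) + 1)"
    using sum_divisor_count_bounds(2)[of m]
      mult_left_mono[of "harm m" "ln (real n) + 1" "real m"]
    unfolding D_def by linarith
  then show "real_of_int (model_prime n) \<le> 1 + (real n - 1) * (ln (real n) + 2)"
    using hi m(3) by (simp add: algebra_simps)
qed

theorem mainTheorem1:
  shows "(\<lambda>n. real_of_int (model_prime n)) \<sim>[at_top] (\<lambda>n. real n * ln (real n))
    \<and> (\<lambda>n. real_of_int (model_prime n) / (real n * ln (real n))) \<longlonglongrightarrow> 1"
proof -
  have ge2: "eventually (\<lambda>n::nat. n \<ge> 2) at_top"
    by (rule eventually_ge_at_top)
  have lim: "(\<lambda>n. real_of_int (model_prime n) / (real n * ln (real n))) \<longlonglongrightarrow> 1"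
  proof (rule tendsto_sandwich)
    show "(\<lambda>n. (1 + (real n - 1) * (ln (real n) - 1)) / (real n * ln (real n))) \<longlonglongrightarrow> 1"
      by real_asymp
    show "(\<lambda>n. (1 + (real n - 1) * (ln (real n) + 2)) / (real n * ln (real n))) \<longlonglongrightarrow> 1"
      by real_asymp
    show "\<forall>\<^sub>F n in at_top. (1 + (real n - 1) * (ln (real n) - 1)) / (real n * ln (real n))
        \<le> real_of_int (model_prime n) / (real n * ln (real n))"
      using ge2 by eventually_elim (intro divide_right_mono model_prime_bounds, auto)
    show "\<forall>\<^sub>F n in at_top. real_of_int (model_prime n) / (real n * ln (real n))
        \<le> (1 + (real n - 1) * (ln (real n) + 2)) / (real n * ln (real n))"
      using ge2 by eventually_elim (intro divide_right_mono model_prime_bounds, auto)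
  qed
  then show ?thesis
    by (simp add: asymp_equivI')
qed

end
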